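(* Let $R$ be a commutative Krasner hyperring with nonzero identity and let $\delta$ be a hyperideal expansion that preserves intersection. If $Q_1,Q_2,\dots,Q_n$ are $\delta$-$r$-hyperideals of $R$ and $P$ is a hyperideal with $P=\delta(Q_i)$ for all $i$, then $Q=\bigcap_{i=1}^{n}Q_i$ is a $\delta$-$r$-hyperideal of $R$.
   Context: A Krasner hyperring $(R,+,\cdot)$ is a set where $(R,+)$ is a canonical hypergroup (a commutative, associative hyperoperation with values nonempty subsets, an element $0$ with $x+0=\{x\}$, unique opposites $-x$ with $0\in x+(-x)$, and $z\in x+y$ implies $y\in -x+z$ and $x\in z-y$), $(R,\cdot)$ is a semigroup (single-valued multiplication) with $0$ bilaterally absorbing, and $\cdot$ is distributive over $+$. It is commutative with nonzero identity if $\cdot$ is commutative with an identity $1\neq 0$. A hyperideal is a nonempty $N\subseteq R$ with $x-y\subseteq N$ and $rx\in N$ for all $x,y\in N$, $r\in R$. For $a\in R$, $ann(a)=\{r\in R: ra=0\}$, and "$ann(a)=0$" means $ann(a)=\{0\}$. A hyperideal expansion is a function $\delta$ assigning to each hyperideal $N$ a hyperideal $\delta(N)$ of the same hyperring such that $N\subseteq\delta(N)$, and $P\subseteq Q$ implies $\delta(P)\subseteq\delta(Q)$. It preserves intersection if $\delta(I\cap J)=\delta(I)\cap\delta(J)$ for all hyperideals $I,J$. A proper hyperideal $N$ is a $\delta$-$r$-hyperideal if for all $a,b\in R$, $a\cdot b\in N$ and $ann(a)=0$ imply $b\in\delta(N)$. *)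

theory Defs
  imports "HOL-Algebra.Group"
begin

record 'a hyperring = "'a monoid" +
  hadd :: "'a \<Rightarrow> 'a \<Rightarrow> 'a set" (infixl "\<boxplus>\<index>" 65)
  hzero :: 'a

text \<open>Well defined on the carrier of a Krasner hyperring, where opposites exist and are unique.\<close>
definition hneg :: "('a, 'm) hyperring_scheme \<Rightarrow> 'a \<Rightarrow> 'a"
  where "hneg R x = (THE y. y \<in> carrier R \<and> hzero R \<in> x \<boxplus>\<^bsub>R\<^esub> y)"

definition hminus :: "('a, 'm) hyperring_scheme \<Rightarrow> 'a \<Rightarrow> 'a \<Rightarrow> 'a set"
  where "hminus R x y = x \<boxplus>\<^bsub>R\<^esub> hneg R y"

text \<open>A hyperoperation extends to sets by taking unions; the two unions in \<open>hadd_assoc\<close>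
  are \<open>(x + y) + z\<close> and \<open>x + (y + z)\<close>.\<close>
locale canonical_hypergroup =
  fixes R :: "('a, 'm) hyperring_scheme" (structure)
  assumes hadd_nonempty: "\<lbrakk>x \<in> carrier R; y \<in> carrier R\<rbrakk> \<Longrightarrow> x \<boxplus> y \<noteq> {}"
    and hadd_closed: "\<lbrakk>x \<in> carrier R; y \<in> carrier R\<rbrakk> \<Longrightarrow> x \<boxplus> y \<subseteq> carrier R"
    and hadd_comm: "\<lbrakk>x \<in> carrier R; y \<in> carrier R\<rbrakk> \<Longrightarrow> x \<boxplus> y = y \<boxplus> x"
    and hadd_assoc: "\<lbrakk>x \<in> carrier R; y \<in> carrier R; z \<in> carrier R\<rbrakk>
      \<Longrightarrow> (\<Union>u \<in> x \<boxplus> y. u \<boxplus> z) = (\<Union>v \<in> y \<boxplus> z. x \<boxplus> v)"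
    and hzero_closed: "hzero R \<in> carrier R"
    and hadd_zero: "x \<in> carrier R \<Longrightarrow> x \<boxplus> hzero R = {x}"
    and opposite_ex1: "x \<in> carrier R \<Longrightarrow> \<exists>!y. y \<in> carrier R \<and> hzero R \<in> x \<boxplus> y"
    and reversible: "\<lbrakk>x \<in> carrier R; y \<in> carrier R; z \<in> x \<boxplus> y\<rbrakk>
      \<Longrightarrow> y \<in> hneg R x \<boxplus> z \<and> x \<in> hminus R z y"

text \<open>Multiplication is only a semigroup here: the record field \<open>\<one>\<close> is unconstrained.\<close>
locale krasner_hyperring = canonical_hypergroup R
  for R :: "('a, 'm) hyperring_scheme" (structure) +
  assumes hmult_closed: "\<lbrakk>x \<in> carrier R; y \<in> carrier R\<rbrakk> \<Longrightarrow> x \<otimes> y \<in> carrier R"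
    and hmult_assoc: "\<lbrakk>x \<in> carrier R; y \<in> carrier R; z \<in> carrier R\<rbrakk>
      \<Longrightarrow> (x \<otimes> y) \<otimes> z = x \<otimes> (y \<otimes> z)"
    and hzero_mult_left: "x \<in> carrier R \<Longrightarrow> hzero R \<otimes> x = hzero R"
    and hzero_mult_right: "x \<in> carrier R \<Longrightarrow> x \<otimes> hzero R = hzero R"
    and distrib_left: "\<lbrakk>x \<in> carrier R; y \<in> carrier R; z \<in> carrier R\<rbrakk>
      \<Longrightarrow> (\<lambda>u. x \<otimes> u) ` (y \<boxplus> z) = (x \<otimes> y) \<boxplus> (x \<otimes> z)"
    and distrib_right: "\<lbrakk>x \<in> carrier R; y \<in> carrier R; z \<in> carrier R\<rbrakk>
      \<Longrightarrow> (\<lambda>u. u \<otimes> x) ` (y \<boxplus> z) = (y \<otimes> x) \<boxplus> (z \<otimes> x)"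

locale comm_krasner_hyperring = krasner_hyperring R + comm_monoid R
  for R :: "('a, 'm) hyperring_scheme" (structure) +
  assumes one_neq_hzero: "\<one> \<noteq> hzero R"

definition hyperideal :: "('a, 'm) hyperring_scheme \<Rightarrow> 'a set \<Rightarrow> bool"
  where "hyperideal R N \<longleftrightarrow> N \<noteq> {} \<and> N \<subseteq> carrier R \<and>
    (\<forall>x \<in> N. \<forall>y \<in> N. hminus R x y \<subseteq> N) \<and>
    (\<forall>r \<in> carrier R. \<forall>x \<in> N. r \<otimes>\<^bsub>R\<^esub> x \<in> N)"

definition ann :: "('a, 'm) hyperring_scheme \<Rightarrow> 'a \<Rightarrow> 'a set"
  where "ann R a = {r \<in> carrier R. r \<otimes>\<^bsub>R\<^esub> a = hzero R}"

text \<open>A function on hyperideals is a total function on sets, of which only the values at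
  hyperideals are constrained (or used).\<close>
definition hyperideal_expansion :: "('a, 'm) hyperring_scheme \<Rightarrow> ('a set \<Rightarrow> 'a set) \<Rightarrow> bool"
  where "hyperideal_expansion R \<delta> \<longleftrightarrow>
    (\<forall>N. hyperideal R N \<longrightarrow> hyperideal R (\<delta> N) \<and> N \<subseteq> \<delta> N) \<and>
    (\<forall>P Q. hyperideal R P \<longrightarrow> hyperideal R Q \<longrightarrow> P \<subseteq> Q \<longrightarrow> \<delta> P \<subseteq> \<delta> Q)"

definition preserves_intersection :: "('a, 'm) hyperring_scheme \<Rightarrow> ('a set \<Rightarrow> 'a set) \<Rightarrow> bool"
  where "preserves_intersection R \<delta> \<longleftrightarrow>
    (\<forall>I J. hyperideal R I \<longrightarrow> hyperideal R J \<longrightarrow> \<delta> (I \<inter> J) = \<delta> I \<inter> \<delta> J)"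

definition delta_r_hyperideal ::
    "('a, 'm) hyperring_scheme \<Rightarrow> ('a set \<Rightarrow> 'a set) \<Rightarrow> 'a set \<Rightarrow> bool"
  where "delta_r_hyperideal R \<delta> N \<longleftrightarrow> hyperideal R N \<and> N \<noteq> carrier R \<and>
    (\<forall>a \<in> carrier R. \<forall>b \<in> carrier R.
      a \<otimes>\<^bsub>R\<^esub> b \<in> N \<longrightarrow> ann R a = {hzero R} \<longrightarrow> b \<in> \<delta> N)"

end

theory Submission
  imports Defs
begin

text \<open>A product \<open>a \<otimes> b\<close> with \<open>ann R a = {hzero R}\<close> that lies in the intersection lies in every
  member \<open>Q i\<close>, so \<open>b\<close> lies in every \<open>\<delta> (Q i)\<close>. What has to be shown is that these memberships
  combine to \<open>b \<in> \<delta> (\<Inter>i. Q i)\<close>, and this is exactly preservation of intersections, extended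
  from two hyperideals to a finite nonempty family (\<open>expansion_Inter\<close>). That extension is an
  induction in which partial intersections must again be hyperideals; the only point there is that
  an intersection of hyperideals is nonempty, because each of them contains zero.\<close>

lemma (in krasner_hyperring) hzero_in_hyperideal:
  assumes "hyperideal R N"
  shows "hzero R \<in> N"
proof -
  obtain x where x: "x \<in> N" "x \<in> carrier R"
    using assms unfolding hyperideal_def by blast
  then have "hzero R \<otimes> x \<in> N"
    using assms hzero_closed unfolding hyperideal_def by blast
  then show ?thesis
    using x by (simp add: hzero_mult_left)
qed

lemma (in krasner_hyperring) hyperideal_Inter:
  assumes "I \<noteq> {}" and "\<And>i. i \<in> I \<Longrightarrow> hyperideal R (Q i)"
  shows "hyperideal R (\<Inter>i\<in>I. Q i)"
proof -
  have "hzero R \<in> (\<Inter>i\<in>I. Q i)"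
    using assms(2) hzero_in_hyperideal by simp
  then have "(\<Inter>i\<in>I. Q i) \<noteq> {}"
    by (metis empty_iff)
  moreover have "(\<Inter>i\<in>I. Q i) \<subseteq> carrier R"
    using assms by (fastforce simp: hyperideal_def)
  moreover have "hminus R x y \<subseteq> (\<Inter>i\<in>I. Q i)"
    if "x \<in> (\<Inter>i\<in>I. Q i)" "y \<in> (\<Inter>i\<in>I. Q i)" for x y
    using that assms(2) by (fastforce simp: hyperideal_def)
  moreover have "r \<otimes> x \<in> (\<Inter>i\<in>I. Q i)"
    if "r \<in> carrier R" "x \<in> (\<Inter>i\<in>I. Q i)" for r x
    using that assms(2) by (fastforce simp: hyperideal_def)
  ultimately show ?thesis
    by (simp add: hyperideal_def)
qed

text \<open>Induction on the index set starts from a single index, since the empty intersection is the whole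
  type and need not be a hyperideal. In the step the hypothesis on \<open>\<delta>\<close> is applied to
  \<open>Q j\<close> and the intersection so far, which is a hyperideal by \<open>hyperideal_Inter\<close>.\<close>

lemma (in krasner_hyperring) expansion_Inter:
  assumes "preserves_intersection R \<delta>"
    and "finite I" and "I \<noteq> {}" and "\<And>i. i \<in> I \<Longrightarrow> hyperideal R (Q i)"
  shows "\<delta> (\<Inter>i\<in>I. Q i) = (\<Inter>i\<in>I. \<delta> (Q i))"
  using assms(2-4)
proof (induction I rule: finite_ne_induct)
  case (singleton j)
  then show ?case by simp
next
  case (insert j J)
  have "hyperideal R (Q j)" "hyperideal R (\<Inter>i\<in>J. Q i)"
    using insert.hyps insert.prems by (auto intro!: hyperideal_Inter)
  then have "\<delta> (Q j \<inter> (\<Inter>i\<in>J. Q i)) = \<delta> (Q j) \<inter> \<delta> (\<Inter>i\<in>J. Q i)"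
    using assms(1) unfolding preserves_intersection_def by blast
  then show ?case
    using insert.IH insert.prems by simp
qed

lemma (in krasner_hyperring) delta_r_hyperideal_Inter:
  assumes "preserves_intersection R \<delta>"
    and "finite I" and "I \<noteq> {}" and Q: "\<And>i. i \<in> I \<Longrightarrow> delta_r_hyperideal R \<delta> (Q i)"
  shows "delta_r_hyperideal R \<delta> (\<Inter>i\<in>I. Q i)"
proof -
  have ideal: "hyperideal R (Q i)" if "i \<in> I" for i
    using Q[OF that] unfolding delta_r_hyperideal_def by blast
  have "hyperideal R (\<Inter>i\<in>I. Q i)"
    using assms(3) ideal by (rule hyperideal_Inter)
  moreover have "(\<Inter>i\<in>I. Q i) \<noteq> carrier R"
  proof -
    obtain j where "j \<in> I" using assms(3) by blast
    then have "(\<Inter>i\<in>I. Q i) \<subseteq> Q j" "Q j \<subset> carrier R"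
      using Q[of j] unfolding delta_r_hyperideal_def hyperideal_def by auto
    then show ?thesis by blast
  qed
  moreover have "b \<in> \<delta> (\<Inter>i\<in>I. Q i)"
    if "a \<in> carrier R" "b \<in> carrier R" "a \<otimes> b \<in> (\<Inter>i\<in>I. Q i)" "ann R a = {hzero R}" for a b
  proof -
    have "b \<in> (\<Inter>i\<in>I. \<delta> (Q i))"
      using that Q by (simp add: delta_r_hyperideal_def)
    then show ?thesis
      using expansion_Inter[of \<delta> I Q] assms(1-3) ideal by simp
  qed
  ultimately show ?thesis
    by (simp add: delta_r_hyperideal_def)
qed

theorem theorem2p7:
  fixes R :: "('a, 'm) hyperring_scheme"
    and \<delta> :: "'a set \<Rightarrow> 'a set"
    and Q :: "nat \<Rightarrow> 'a set"
    and P :: "'a set"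
    and n :: nat
  assumes "comm_krasner_hyperring R"
    and "hyperideal_expansion R \<delta>"
    and "preserves_intersection R \<delta>"
    and "n \<ge> 1"
    and "\<forall>i \<in> {1..n}. delta_r_hyperideal R \<delta> (Q i)"
    and "hyperideal R P"
    and "\<forall>i \<in> {1..n}. P = \<delta> (Q i)"
  shows "delta_r_hyperideal R \<delta> (\<Inter>i \<in> {1..n}. Q i)"
proof -
  interpret comm_krasner_hyperring R by fact
  show ?thesis
    using assms(3-5) by (intro delta_r_hyperideal_Inter) auto
qed

end
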